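(* Let $G$ be an $n$-vertex graph of maximum degree $\Delta$ such that, for every vertex $u \in V(G)$, the subgraph $G[N(u)]$ induced by the neighbourhood of $u$ has average degree at most $d$, where $d \le \frac{\Delta}{6}-1$. Write $\rho \coloneqq \Delta/(d+1)$ and let $\ell \ge (d+1)(\ln \rho)^3$. Then for every list assignment $L\colon V(G)\to 2^{\mathbb{N}}$ with \[|L(v)| \ge \left(1+\frac{2}{\ln \rho}\right) \frac{\deg(v)}{W\left(\frac{\deg(v)}{\ell}\right)}\] for every vertex $v\in V(G)$, there are at least $\ell^n$ proper $L$-colourings of $G$.
   Context: $W$ denotes the Lambert $W$-function, i.e. the inverse of the function $z \mapsto z e^z$ on $[0,\infty)$. A list assignment of $G$ is a map $L\colon V(G)\to 2^{\mathbb{N}}$; a proper $L$-colouring is a map $c\colon V(G)\to\mathbb{N}$ with $c(v)\in L(v)$ for every vertex $v$ and $c(u)\neq c(v)$ for every edge $uv$. *)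

theory Defs
  imports Complex_Main "HOL-Library.FuncSet"
begin

definition simple_graph :: "'v set \<Rightarrow> 'v set set \<Rightarrow> bool" where
  "simple_graph V E \<longleftrightarrow> finite V \<and> (\<forall>e\<in>E. e \<subseteq> V \<and> card e = 2)"

definition nbhd :: "'v set set \<Rightarrow> 'v \<Rightarrow> 'v set" where
  "nbhd E v = {w. {v, w} \<in> E}"

definition vertex_degree :: "'v set set \<Rightarrow> 'v \<Rightarrow> nat" where
  "vertex_degree E v = card (nbhd E v)"

definition max_degree :: "'v set \<Rightarrow> 'v set set \<Rightarrow> nat" where
  "max_degree V E = Max (vertex_degree E ` V)"

(* The average degree of the graph without vertices is 0, because x / 0 = 0. *)
definition average_degree :: "'v set \<Rightarrow> 'v set set \<Rightarrow> real" where
  "average_degree V E = (\<Sum>v\<in>V. real (vertex_degree E v)) / real (card V)"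

definition induced_edges :: "'v set set \<Rightarrow> 'v set \<Rightarrow> 'v set set" where
  "induced_edges E S = {e \<in> E. e \<subseteq> S}"

definition lambert_W :: "real \<Rightarrow> real" where
  "lambert_W = inv_into {0..} (\<lambda>z. z * exp z)"

(* The function x / W (x / l) for x \<ge> 0 and l > 0. As W y * exp (W y) = y, it equals
   l * exp (W (x / l)) for x > 0, so its continuous extension to x = 0 has the value l there.
   Plain HOL division would give 0 / 0 = 0 instead, so that isolated vertices could
   have empty lists. *)
definition div_lambert_W :: "real \<Rightarrow> real \<Rightarrow> real" where
  "div_lambert_W l x = (if x = 0 then l else x / lambert_W (x / l))"

(* Colourings are extensional (undefined outside V), so each map on V is counted once. *)
definition proper_list_colourings ::
  "'v set \<Rightarrow> 'v set set \<Rightarrow> ('v \<Rightarrow> nat set) \<Rightarrow> ('v \<Rightarrow> nat) set" where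
  "proper_list_colourings V E L =
     {c \<in> Pi\<^sub>E V L. \<forall>u\<in>V. \<forall>v\<in>V. {u, v} \<in> E \<longrightarrow> c u \<noteq> c v}"

(* Lists may be infinite, whereas card of an infinite set is 0. *)
definition card_at_least :: "'b set \<Rightarrow> real \<Rightarrow> bool" where
  "card_at_least A r \<longleftrightarrow> infinite A \<or> real (card A) \<ge> r"

end

theory Submission imports Defs begin

text \<open>
  By induction on \<open>T \<subseteq> V\<close>, adding a vertex \<open>v\<close> multiplies the number of proper colourings
  by at least \<open>l\<close> (Rosenfeld's counting argument). Let \<open>c\<close> be a uniformly random proper
  colouring of \<open>T\<close>, let \<open>M\<close> be the set of neighbours of \<open>v\<close> in \<open>T\<close>, and let \<open>e u\<close> be the number
  of neighbours of \<open>u\<close> in \<open>M\<close>. Call \<open>u \<in> M\<close> bad if the colouring outside \<open>M\<close> leaves fewer than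
  \<open>e u + 1 + s\<close> colours for \<open>u\<close>, where \<open>s = (d + 1) ln \<rho>\<close>. By the induction hypothesis
  \<open>u\<close> is bad with probability at most \<open>(e u + 1 + s) / l\<close>, so few colours are lost to bad
  vertices on average. Fix the colouring outside \<open>M\<close>. If it leaves \<open>m\<close> colours for a good
  vertex \<open>u\<close>, then whatever the colouring of the rest of \<open>M\<close>, the vertex \<open>u\<close> takes a given
  colour with probability at most \<open>1 / (m - e u)\<close>. Hence a colour \<open>x\<close> avoided by the bad
  vertices survives with probability at least \<open>exp (- \<sigma> x)\<close>, where \<open>\<sigma> x\<close> is the sum of
  \<open>1 / (m - e u - 1)\<close> over the good \<open>u\<close> to which \<open>x\<close> is left, and the sum of \<open>\<sigma> x\<close> over all \<open>x\<close> is at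
  most \<open>deg v (1 + 1 / ln \<rho>)\<close>. Bounding \<open>exp\<close> from below by its tangent at \<open>- W (deg v / l)\<close> makes
  everything linear, so that one can average over the colourings outside \<open>M\<close>.
\<close>

section \<open>Available colours and one-vertex extensions of colourings\<close>

text \<open>The set \<open>T\<close> is separate from the domain of \<open>c\<close> because one and
  the same colouring is examined relative to \<open>T\<close>, \<open>T - {u}\<close> and
  \<open>T - M\<close>; \<open>u\<close> itself may be coloured already.\<close>

definition available ::
  "'v set set \<Rightarrow> ('v \<Rightarrow> nat set) \<Rightarrow> ('v \<Rightarrow> nat) \<Rightarrow> 'v set \<Rightarrow> 'v \<Rightarrow> nat set" where
  "available E L c T u = L u - c ` (nbhd E u \<inter> T)"

lemma nbhd_sym: "u \<in> nbhd E v \<longleftrightarrow> v \<in> nbhd E u"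
  by (simp add: nbhd_def insert_commute)

lemma proper_list_colourings_iff:
  "c \<in> proper_list_colourings V E L \<longleftrightarrow>
     c \<in> Pi\<^sub>E V L \<and> (\<forall>u\<in>V. \<forall>v\<in>V. v \<in> nbhd E u \<longrightarrow> c u \<noteq> c v)"
  by (simp add: proper_list_colourings_def nbhd_def)

lemma finite_proper_list_colourings:
  assumes "finite T" "\<And>u. u \<in> T \<Longrightarrow> finite (L u)"
  shows "finite (proper_list_colourings T E L)"
proof (rule finite_subset)
  show "proper_list_colourings T E L \<subseteq> Pi\<^sub>E T L"
    by (auto simp: proper_list_colourings_def)
qed (use assms in \<open>auto intro: finite_PiE\<close>)

lemma available_cong:
  "(\<And>w. w \<in> nbhd E u \<inter> T \<Longrightarrow> c w = c' w) \<Longrightarrow> available E L c T u = available E L c' T u"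
  unfolding available_def by (rule arg_cong[OF image_cong[OF refl]]) auto

lemma available_fun_upd [simp]: "v \<notin> T \<Longrightarrow> available E L (c(v := y)) T u = available E L c T u"
  by (rule available_cong) auto

lemma extend_proper_colouring:
  assumes c: "c \<in> proper_list_colourings T E L" and "v \<notin> T" and "v \<notin> nbhd E v"
    and y: "y \<in> available E L c T v"
  shows "c(v := y) \<in> proper_list_colourings (insert v T) E L"
proof -
  have "c(v := y) \<in> Pi\<^sub>E (insert v T) L"
    using c y by (auto simp: proper_list_colourings_iff available_def PiE_iff extensional_def)
  moreover have "(c(v := y)) u \<noteq> (c(v := y)) w"
    if "u \<in> insert v T" "w \<in> insert v T" "w \<in> nbhd E u" for u w
  proof (cases "u = v")
    case True
    then have "w \<noteq> v" "w \<in> nbhd E v \<inter> T" using that assms(3) by auto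
    then show ?thesis using y True by (auto simp: available_def)
  next
    case False
    note uv = False
    show ?thesis
    proof (cases "w = v")
      case True
      then have "u \<in> nbhd E v \<inter> T" using that uv nbhd_sym by fastforce
      then show ?thesis using y True uv by (auto simp: available_def)
    next
      case False
      then show ?thesis using that uv c by (auto simp: proper_list_colourings_iff)
    qed
  qed
  ultimately show ?thesis by (auto simp: proper_list_colourings_iff)
qed

lemma restrict_proper_colouring:
  assumes "c \<in> proper_list_colourings T E L" and "S \<subseteq> T"
  shows "restrict c S \<in> proper_list_colourings S E L"
  using assms by (auto simp: proper_list_colourings_iff PiE_iff subset_iff)

lemma proper_colouring_in_available:
  assumes "c \<in> proper_list_colourings T E L" and "S \<subseteq> T" and "u \<in> T"
  shows "c u \<in> available E L c S u"
  unfolding available_def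
proof
  show "c u \<in> L u" using assms by (auto simp: proper_list_colourings_iff)
  show "c u \<notin> c ` (nbhd E u \<inter> S)"
  proof
    assume "c u \<in> c ` (nbhd E u \<inter> S)"
    then obtain w where "w \<in> nbhd E u" "w \<in> S" "c u = c w" by blast
    then show False using assms by (auto simp: proper_list_colourings_iff)
  qed
qed

text \<open>Counting colourings of \<open>insert v T\<close> becomes summing, over colourings of
  \<open>T\<close>, the number of colours left for \<open>v\<close>. Extensionality makes
  restriction to \<open>T\<close> the exact inverse.\<close>

lemma bij_betw_extend_colouring:
  assumes "v \<notin> T" and "v \<notin> nbhd E v"
  shows "bij_betw (\<lambda>(c, y). c(v := y))
    (SIGMA c : proper_list_colourings T E L. available E L c T v)
    (proper_list_colourings (insert v T) E L)"
proof (rule bij_betw_byWitness[where f' = "\<lambda>c. (restrict c T, c v)"])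
  have ext: "c v = undefined" if "c \<in> proper_list_colourings T E L" for c
    using that assms(1) by (auto simp: proper_list_colourings_iff PiE_iff extensional_def)
  show "\<forall>p\<in>SIGMA c : proper_list_colourings T E L. available E L c T v.
      (\<lambda>c. (restrict c T, c v)) ((\<lambda>(c, y). c(v := y)) p) = p"
    using assms(1) by (auto simp: proper_list_colourings_iff PiE_iff extensional_def restrict_def)
  show "\<forall>c\<in>proper_list_colourings (insert v T) E L.
      (\<lambda>(c, y). c(v := y)) (restrict c T, c v) = c"
    using assms(1) by (auto simp: proper_list_colourings_iff PiE_iff extensional_def restrict_def)
  show "(\<lambda>(c, y). c(v := y)) ` (SIGMA c : proper_list_colourings T E L. available E L c T v)
      \<subseteq> proper_list_colourings (insert v T) E L"
    using assms by (auto intro: extend_proper_colouring)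
  show "(\<lambda>c. (restrict c T, c v)) ` proper_list_colourings (insert v T) E L
      \<subseteq> (SIGMA c : proper_list_colourings T E L. available E L c T v)"
  proof clarify
    fix c assume c: "c \<in> proper_list_colourings (insert v T) E L"
    have "available E L (restrict c T) T v = available E L c T v"
      by (rule available_cong) auto
    then show "restrict c T \<in> proper_list_colourings T E L \<and> c v \<in> available E L (restrict c T) T v"
      using restrict_proper_colouring[OF c, of T] proper_colouring_in_available[OF c, of T v] by auto
  qed
qed

lemma finite_available: "finite (L u) \<Longrightarrow> finite (available E L c T u)"
  by (simp add: available_def)

lemma card_extensions:
  assumes "finite T" "\<And>u. u \<in> insert v T \<Longrightarrow> finite (L u)" "v \<notin> T" "v \<notin> nbhd E v"
  shows "card (proper_list_colourings (insert v T) E L) =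
    (\<Sum>c\<in>proper_list_colourings T E L. card (available E L c T v))"
proof -
  have "card (proper_list_colourings (insert v T) E L) =
    card (SIGMA c : proper_list_colourings T E L. available E L c T v)"
    by (rule bij_betw_same_card[symmetric], rule bij_betw_extend_colouring) fact+
  also have "\<dots> = (\<Sum>c\<in>proper_list_colourings T E L. card (available E L c T v))"
    using assms by (intro card_SigmaI) (auto intro: finite_proper_list_colourings finite_available)
  finally show ?thesis .
qed

text \<open>A colouring of \<open>T\<close> that leaves fewer than \<open>t\<close> colours for
  \<open>v\<close> has fewer than \<open>t\<close> extensions. Combined with the growth factor
  \<open>l\<close>, this bounds the probability of being bad by \<open>t / l\<close>.\<close>

lemma card_few_available:
  fixes t :: real
  assumes "finite T" "\<And>u. u \<in> insert v T \<Longrightarrow> finite (L u)" "v \<notin> T" "v \<notin> nbhd E v" "t \<ge> 0"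
  shows "card {c \<in> proper_list_colourings (insert v T) E L. card (available E L c T v) < t}
    \<le> t * card (proper_list_colourings T E L)"
proof -
  let ?P = "proper_list_colourings T E L"
  let ?Q = "{c \<in> ?P. card (available E L c T v) < t}"
  have finP: "finite ?P" using assms by (auto intro: finite_proper_list_colourings)
  have "{c \<in> proper_list_colourings (insert v T) E L. card (available E L c T v) < t}
     \<subseteq> (\<lambda>(c, y). c(v := y)) ` (SIGMA c : ?Q. available E L c T v)"
  proof clarify
    fix c assume c: "c \<in> proper_list_colourings (insert v T) E L"
      and t: "card (available E L c T v) < t"
    have "c \<in> (\<lambda>(c, y). c(v := y)) ` (SIGMA c : ?P. available E L c T v)"
      using bij_betw_extend_colouring[OF assms(3,4), of L] c by (simp add: bij_betw_def)
    then obtain c' y where "c' \<in> ?P" "y \<in> available E L c' T v" "c = c'(v := y)" by auto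
    then show "c \<in> (\<lambda>(c, y). c(v := y)) ` (SIGMA c : ?Q. available E L c T v)"
      using t assms(3) by (intro image_eqI[where x = "(c', y)"]) auto
  qed
  then have "card {c \<in> proper_list_colourings (insert v T) E L. card (available E L c T v) < t}
     \<le> card (SIGMA c : ?Q. available E L c T v)"
    using finP assms(2) by (intro surj_card_le finite_SigmaI) (auto intro: finite_available)
  also have "\<dots> = (\<Sum>c\<in>?Q. card (available E L c T v))"
    using finP assms(2) by (intro card_SigmaI) (auto intro: finite_available)
  finally have "real (card {c \<in> proper_list_colourings (insert v T) E L. card (available E L c T v) < t})
     \<le> (\<Sum>c\<in>?Q. real (card (available E L c T v)))"
    unfolding of_nat_sum[symmetric] of_nat_le_iff .
  also have "\<dots> \<le> (\<Sum>c\<in>?Q. t)" by (intro sum_mono) auto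
  also have "\<dots> = t * card ?Q" by simp
  also have "\<dots> \<le> t * card ?P"
    using assms(5) finP by (intro mult_left_mono) (auto intro: card_mono)
  finally show ?thesis .
qed

section \<open>Survival of a single colour\<close>

text \<open>Recolouring \<open>u\<close> in a colouring with \<open>c u = x\<close> gives at least
  \<open>y\<close> members of \<open>K\<close> that still satisfy \<open>Q\<close>. These are
  distinct for distinct pairs, since resetting \<open>u\<close> to \<open>x\<close> recovers the
  original. So at most a fraction \<open>1 / y\<close> has colour \<open>x\<close> at
  \<open>u\<close>.\<close>

lemma card_avoiding_colour:
  fixes K :: "('v \<Rightarrow> 'b) set" and y :: real
  assumes "finite K" and y: "y > 0"
    and many: "\<And>c. c \<in> K \<Longrightarrow> y \<le> card {z. c(u := z) \<in> K}"
    and fin: "\<And>c. c \<in> K \<Longrightarrow> finite {z. c(u := z) \<in> K}"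
    and inv: "\<And>c z. Q (c(u := z)) \<longleftrightarrow> Q c"
  shows "(1 - 1 / y) * card {c \<in> K. Q c} \<le> card {c \<in> K. Q c \<and> c u \<noteq> x}"
proof -
  let ?H = "{c \<in> K. Q c \<and> c u = x}"
  have "inj_on (\<lambda>(c, z). c(u := z)) (SIGMA c : ?H. {z. c(u := z) \<in> K})"
  proof (rule inj_onI; clarify)
    fix c z c' z'
    assume *: "c(u := z) = c'(u := z')" "x = c u" "c' u = c u"
    have "c = (c(u := z))(u := c u)" by simp
    also have "\<dots> = c'" unfolding *(1) using *(3)[symmetric] by simp
    finally show "c = c' \<and> z = z'" using fun_cong[OF *(1), of u] by simp
  qed
  then have "card (SIGMA c : ?H. {z. c(u := z) \<in> K}) \<le> card {c \<in> K. Q c}"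
    using assms(1) inv by (intro card_inj_on_le[where f = "\<lambda>(c, z). c(u := z)"]) auto
  also have "card (SIGMA c : ?H. {z. c(u := z) \<in> K}) = (\<Sum>c\<in>?H. card {z. c(u := z) \<in> K})"
    using assms(1) fin by (intro card_SigmaI) auto
  finally have "(\<Sum>c\<in>?H. real (card {z. c(u := z) \<in> K})) \<le> card {c \<in> K. Q c}"
    unfolding of_nat_sum[symmetric] of_nat_le_iff .
  moreover have "(\<Sum>c\<in>?H. y) \<le> (\<Sum>c\<in>?H. real (card {z. c(u := z) \<in> K}))"
    using many by (intro sum_mono) auto
  ultimately have "card ?H * y \<le> real (card {c \<in> K. Q c})" by simp
  then have 1: "real (card ?H) \<le> card {c \<in> K. Q c} / y" using y by (simp add: field_simps)
  have "{c \<in> K. Q c \<and> c u \<noteq> x} \<union> ?H = {c \<in> K. Q c}" by auto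
  then have "card {c \<in> K. Q c} = card {c \<in> K. Q c \<and> c u \<noteq> x} + card ?H"
    using assms(1) by (subst card_Un_disjoint[symmetric]) auto
  then show ?thesis using 1 by (simp add: algebra_simps add_divide_distrib)
qed

text \<open>The tangent of the convex function exp at \<open>- \<theta>\<close>, evaluated at
  \<open>- a\<close>.\<close>

lemma exp_tangent_le: "exp (- \<theta>) * (1 + \<theta> - a) \<le> exp (- a)" for a \<theta> :: real
proof -
  have "exp (- \<theta>) * (1 + (\<theta> - a)) \<le> exp (- \<theta>) * exp (\<theta> - a)"
    by (intro mult_left_mono) auto
  then show ?thesis by (simp add: exp_add[symmetric] algebra_simps)
qed

text \<open>Turns a product of survival factors into the exponential of a sum, at the price of
  \<open>y - 1\<close> in place of \<open>y\<close>. It is the reciprocal of 1 + t \<le> exp t at t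
  = 1 / (y - 1).\<close>

lemma exp_neg_inverse_le:
  fixes y :: real
  assumes "y > 1"
  shows "exp (- (1 / (y - 1))) \<le> 1 - 1 / y"
proof -
  have "y / (y - 1) = 1 + 1 / (y - 1)" using assms by (simp add: field_simps)
  also have "\<dots> \<le> exp (1 / (y - 1))" by simp
  finally have "inverse (exp (1 / (y - 1))) \<le> inverse (y / (y - 1))"
    using assms by (intro le_imp_inverse_le) auto
  also have "\<dots> = 1 - 1 / y" using assms by (simp add: field_simps)
  finally show ?thesis by (simp add: exp_minus)
qed

lemma recolour_vertex:
  assumes c: "c \<in> proper_list_colourings T E L" and u: "u \<in> T" "u \<notin> nbhd E u"
    and z: "z \<in> available E L c (T - {u}) u"
  shows "c(u := z) \<in> proper_list_colourings T E L"
proof -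
  let ?c = "restrict c (T - {u})"
  have "?c \<in> proper_list_colourings (T - {u}) E L"
    by (rule restrict_proper_colouring[OF c]) auto
  moreover have "available E L ?c (T - {u}) u = available E L c (T - {u}) u"
    by (rule available_cong) auto
  ultimately have "?c(u := z) \<in> proper_list_colourings (insert u (T - {u})) E L"
    using u z by (intro extend_proper_colouring) auto
  moreover have "?c(u := z) = c(u := z)"
    using c by (auto simp: proper_list_colourings_iff PiE_iff extensional_def restrict_def)
  ultimately show ?thesis using u by (simp add: insert_absorb)
qed

text \<open>Passing from \<open>T - M\<close> to \<open>T - {u}\<close> costs at most the colours on
  the neighbours of \<open>u\<close> in \<open>M\<close>.\<close>

lemma card_available_diff_le:
  assumes "finite T" "finite (L u)" "M \<subseteq> T" "u \<in> M" "u \<notin> nbhd E u"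
  shows "card (available E L c (T - M) u) \<le>
    card (available E L c (T - {u}) u) + card (nbhd E u \<inter> M)"
proof -
  have fin: "finite (nbhd E u \<inter> M)" using assms finite_subset by blast
  have "available E L c (T - M) u \<subseteq> available E L c (T - {u}) u \<union> c ` (nbhd E u \<inter> M)"
    using assms by (auto simp: available_def)
  then have "card (available E L c (T - M) u) \<le>
      card (available E L c (T - {u}) u \<union> c ` (nbhd E u \<inter> M))"
    using fin assms(2) by (intro card_mono) (auto intro: finite_available)
  also have "\<dots> \<le> card (available E L c (T - {u}) u) + card (c ` (nbhd E u \<inter> M))"
    by (rule card_Un_le)
  also have "card (c ` (nbhd E u \<inter> M)) \<le> card (nbhd E u \<inter> M)"
    by (rule card_image_le[OF fin])
  finally show ?thesis by simp
qed

text \<open>The event of conditioning on the colouring outside \<open>M\<close>: nonempty classes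
  partition the proper colourings of \<open>T\<close>.\<close>

definition colouring_class ::
  "'v set \<Rightarrow> 'v set set \<Rightarrow> ('v \<Rightarrow> nat set) \<Rightarrow> 'v set \<Rightarrow> ('v \<Rightarrow> nat) \<Rightarrow> ('v \<Rightarrow> nat) set" where
  "colouring_class T E L M c\<^sub>0 = {c \<in> proper_list_colourings T E L. restrict c (T - M) = c\<^sub>0}"

lemma finite_colouring_class:
  assumes "finite T" "\<And>u. u \<in> T \<Longrightarrow> finite (L u)"
  shows "finite (colouring_class T E L M c\<^sub>0)"
  using finite_proper_list_colourings[OF assms] by (simp add: colouring_class_def)

lemma available_colouring_class:
  "c \<in> colouring_class T E L M c\<^sub>0 \<Longrightarrow> available E L c (T - M) u = available E L c\<^sub>0 (T - M) u"
  by (rule available_cong) (auto simp: colouring_class_def)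

text \<open>Vertices of \<open>H\<close> are treated one at a time. Recolouring \<open>u\<close>
  stays inside the class because \<open>u\<close> lies in \<open>M\<close>, and at least
  \<open>y u\<close> colours are possible whatever the rest of \<open>M\<close> does. The conditions
  imposed so far ignore the colour of \<open>u\<close>, so each new vertex costs a factor
  \<open>1 - 1 / y u\<close>. Later \<open>Q\<close> says that the bad vertices avoid
  \<open>x\<close>.\<close>

lemma card_avoiding_colour_on:
  fixes y :: "'v \<Rightarrow> real"
  assumes fin: "finite T" "\<And>u. u \<in> T \<Longrightarrow> finite (L u)" and loopless: "\<And>u. u \<notin> nbhd E u"
    and "M \<subseteq> T" and "finite H" "H \<subseteq> M" "\<And>u. u \<in> H \<Longrightarrow> y u > 1"
    and "\<And>u. u \<in> H \<Longrightarrow> y u + card (nbhd E u \<inter> M) \<le> card (available E L c\<^sub>0 (T - M) u)"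
    and "\<And>c u z. u \<in> H \<Longrightarrow> Q (c(u := z)) \<longleftrightarrow> Q c"
  shows "exp (- (\<Sum>u\<in>H. 1 / (y u - 1))) * card {c \<in> colouring_class T E L M c\<^sub>0. Q c}
    \<le> card {c \<in> colouring_class T E L M c\<^sub>0. Q c \<and> (\<forall>u\<in>H. c u \<noteq> x)}"
  using assms(5-)
proof (induction H)
  case empty
  then show ?case by simp
next
  case (insert u H)
  let ?K = "colouring_class T E L M c\<^sub>0"
  let ?Q = "\<lambda>c. Q c \<and> (\<forall>u\<in>H. c u \<noteq> x)"
  have u: "u \<in> M" "u \<in> T" using insert.prems \<open>M \<subseteq> T\<close> by auto
  have y: "y u > 1" using insert.prems by simp
  have fib: "available E L c (T - {u}) u \<subseteq> {z. c(u := z) \<in> ?K}" "finite {z. c(u := z) \<in> ?K}"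
    if "c \<in> ?K" for c
  proof -
    have "restrict (c(u := z)) (T - M) = c\<^sub>0" for z
      using that u by (auto simp: colouring_class_def)
    moreover have "c \<in> proper_list_colourings T E L" using that by (simp add: colouring_class_def)
    ultimately show "available E L c (T - {u}) u \<subseteq> {z. c(u := z) \<in> ?K}"
      using recolour_vertex[of c T E L u] u loopless by (auto simp: colouring_class_def)
    have "{z. c(u := z) \<in> ?K} \<subseteq> L u"
    proof clarify
      fix z assume "c(u := z) \<in> ?K"
      then have "(c(u := z)) u \<in> L u"
        using u unfolding colouring_class_def proper_list_colourings_iff by blast
      then show "z \<in> L u" by simp
    qed
    then show "finite {z. c(u := z) \<in> ?K}" using fin(2) u finite_subset by blast
  qed
  have many: "y u \<le> card {z. c(u := z) \<in> ?K}" if "c \<in> ?K" for c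
  proof -
    have "y u + card (nbhd E u \<inter> M) \<le> card (available E L c (T - M) u)"
      using insert.prems available_colouring_class[OF that] by simp
    also have "\<dots> \<le> real (card (available E L c (T - {u}) u) + card (nbhd E u \<inter> M))"
      using u fin \<open>M \<subseteq> T\<close> loopless by (intro of_nat_mono card_available_diff_le) auto
    finally have "y u \<le> card (available E L c (T - {u}) u)" by simp
    also have "\<dots> \<le> card {z. c(u := z) \<in> ?K}"
      using fib[OF that] by (intro of_nat_mono card_mono)
    finally show ?thesis .
  qed
  have "exp (- (\<Sum>u\<in>insert u H. 1 / (y u - 1))) * card {c \<in> ?K. Q c} =
      exp (- (1 / (y u - 1))) * (exp (- (\<Sum>u\<in>H. 1 / (y u - 1))) * card {c \<in> ?K. Q c})"
    using insert.hyps by (simp add: exp_add[symmetric])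
  also have "\<dots> \<le> exp (- (1 / (y u - 1))) * card {c \<in> ?K. ?Q c}"
    using insert.prems by (intro mult_left_mono insert.IH) auto
  also have "\<dots> \<le> (1 - 1 / y u) * card {c \<in> ?K. ?Q c}"
    using y by (intro mult_right_mono exp_neg_inverse_le) auto
  also have "\<dots> \<le> card {c \<in> ?K. ?Q c \<and> c u \<noteq> x}"
  proof (rule card_avoiding_colour)
    show "finite ?K" using fin by (rule finite_colouring_class)
    show "?Q (c(u := z)) \<longleftrightarrow> ?Q c" for c z
      using insert.prems(4)[of u c z] insert.hyps by (metis fun_upd_other insertI1)
  qed (use y many fib in auto)
  also have "{c \<in> ?K. ?Q c \<and> c u \<noteq> x} = {c \<in> ?K. Q c \<and> (\<forall>u\<in>insert u H. c u \<noteq> x)}" by auto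
  finally show ?case .
qed

section \<open>Averaging over colours and over colourings\<close>

text \<open>Within a class the bad set and the exponents \<open>\<sigma> x\<close> are constant. The
  tangent bound is linear in \<open>\<sigma> x\<close>, so after summing over the colours of
  \<open>L v\<close> only the total of \<open>\<sigma>\<close>, at most \<open>a\<close>,
  matters.\<close>

lemma sum_available_class_ge:
  fixes s a \<theta> :: real
  assumes fin: "finite T" "\<And>u. u \<in> insert v T \<Longrightarrow> finite (L u)"
    and loopless: "\<And>u. u \<notin> nbhd E u" and "s > 0" "\<theta> \<ge> 0"
  defines "M \<equiv> nbhd E v \<inter> T"
  defines "B \<equiv> \<lambda>c. {u \<in> M. card (available E L c (T - M) u) < real (card (nbhd E u \<inter> M)) + 1 + s}"
  assumes a: "(\<Sum>u\<in>M. 1 + (real (card (nbhd E u \<inter> M)) + 1) / s) \<le> a"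
  shows "(\<Sum>c\<in>colouring_class T E L M c\<^sub>0.
      exp (- \<theta>) * ((1 + \<theta>) * (real (card (L v)) - card (B c)) - a))
    \<le> (\<Sum>c\<in>colouring_class T E L M c\<^sub>0. real (card (available E L c T v)))"
proof -
  define K where "K = colouring_class T E L M c\<^sub>0"
  \<comment> \<open>\<open>A u\<close> is what the outside colouring leaves for \<open>u\<close>,
    \<open>y u\<close> the number of choices still guaranteed when the rest of \<open>M\<close> is
    coloured too. \<open>H x\<close> collects the good vertices that could take colour
    \<open>x\<close>.\<close>
  define A where "A = (\<lambda>u. available E L c\<^sub>0 (T - M) u)"
  define y where "y = (\<lambda>u. real (card (A u)) - card (nbhd E u \<inter> M))"
  define H where "H = (\<lambda>x. {u \<in> M - B c\<^sub>0. x \<in> A u})"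
  define \<sigma> where "\<sigma> = (\<lambda>x. \<Sum>u\<in>H x. 1 / (y u - 1))"
  have MT: "M \<subseteq> T" by (auto simp: M_def)
  then have finM: "finite M" using fin finite_subset by blast
  have finA: "finite (A u)" if "u \<in> M" for u
    using that fin MT unfolding A_def by (intro finite_available) auto
  have finK: "finite K" unfolding K_def using fin by (intro finite_colouring_class) auto
  have BK: "B c = B c\<^sub>0" if "c \<in> K" for c
    using available_colouring_class[of c T E L M c\<^sub>0] that by (simp add: B_def K_def)
  have y: "y u - 1 \<ge> s" if "u \<in> M - B c\<^sub>0" for u
    using that by (auto simp: y_def B_def A_def)
  have x: "exp (- \<theta>) * ((1 + \<theta>) * card {c \<in> K. x \<notin> c ` B c\<^sub>0} - card K * \<sigma> x)
      \<le> card {c \<in> K. x \<notin> c ` M}" for x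
  proof -
    \<comment> \<open>The factor of \<open>\<sigma> x\<close> is enlarged to \<open>card K\<close>,
      which does not depend on \<open>x\<close>, so that summing over \<open>x\<close> leaves just
      the total of \<open>\<sigma>\<close>.\<close>
    have "(1 + \<theta>) * card {c \<in> K. x \<notin> c ` B c\<^sub>0} - card K * \<sigma> x
        \<le> (1 + \<theta> - \<sigma> x) * card {c \<in> K. x \<notin> c ` B c\<^sub>0}"
    proof -
      have "\<sigma> x \<ge> 0" unfolding \<sigma>_def H_def
        using y \<open>s > 0\<close> by (intro sum_nonneg) (fastforce intro!: divide_nonneg_nonneg)
      then have "\<sigma> x * card {c \<in> K. x \<notin> c ` B c\<^sub>0} \<le> \<sigma> x * card K"
        using finK by (intro mult_left_mono of_nat_mono card_mono) auto
      then show ?thesis by (simp add: algebra_simps)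
    qed
    then have "exp (- \<theta>) * ((1 + \<theta>) * card {c \<in> K. x \<notin> c ` B c\<^sub>0} - card K * \<sigma> x)
        \<le> exp (- \<theta>) * (1 + \<theta> - \<sigma> x) * card {c \<in> K. x \<notin> c ` B c\<^sub>0}"
      by (simp add: mult.assoc)
    also have "\<dots> \<le> exp (- \<sigma> x) * card {c \<in> K. x \<notin> c ` B c\<^sub>0}"
      by (intro mult_right_mono exp_tangent_le) auto
    also have "\<dots> \<le> card {c \<in> K. x \<notin> c ` B c\<^sub>0 \<and> (\<forall>u\<in>H x. c u \<noteq> x)}"
      unfolding \<sigma>_def K_def
    proof (rule card_avoiding_colour_on[OF fin(1) _ loopless MT])
      show "finite (H x)" "H x \<subseteq> M" using finM by (auto simp: H_def)
      show "y u > 1" if "u \<in> H x" for u using y[of u] that \<open>s > 0\<close> by (auto simp: H_def)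
      show "y u + card (nbhd E u \<inter> M) \<le> card (available E L c\<^sub>0 (T - M) u)" for u
        by (simp add: y_def A_def)
      show "x \<notin> (c(u := z)) ` B c\<^sub>0 \<longleftrightarrow> x \<notin> c ` B c\<^sub>0" if "u \<in> H x" for c u z
        using that by (auto simp: H_def)
    qed (use fin in auto)
    also have "\<dots> \<le> card {c \<in> K. x \<notin> c ` M}"
    proof (intro of_nat_mono card_mono)
      \<comment> \<open>A vertex of \<open>M\<close> with colour \<open>x\<close> has
        \<open>x\<close> in its \<open>A u\<close>, so it is either bad or in
        \<open>H x\<close>.\<close>
      show "{c \<in> K. x \<notin> c ` B c\<^sub>0 \<and> (\<forall>u\<in>H x. c u \<noteq> x)} \<subseteq> {c \<in> K. x \<notin> c ` M}"
      proof clarify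
        fix c u assume c: "c \<in> K" "c u \<notin> c ` B c\<^sub>0" "\<forall>w\<in>H (c u). c w \<noteq> c u" and u: "u \<in> M"
        have "c u \<in> A u"
          using c(1) proper_colouring_in_available[of c T E L "T - M" u] MT u
            available_colouring_class[of c T E L M c\<^sub>0 u]
          by (auto simp: K_def A_def colouring_class_def)
        then have "u \<in> H (c u)" using c u by (auto simp: H_def)
        then show False using c by blast
      qed
    qed (use finK in auto)
    finally show ?thesis .
  qed
  have \<sigma>: "(\<Sum>x\<in>L v. \<sigma> x) \<le> a"
  proof -
    have "(\<Sum>x\<in>L v. \<sigma> x) = (\<Sum>u\<in>M - B c\<^sub>0. \<Sum>x | x \<in> L v \<and> x \<in> A u. 1 / (y u - 1))"
      unfolding \<sigma>_def H_def using finM fin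
      by (intro sum.swap_restrict) auto
    also have "\<dots> \<le> (\<Sum>u\<in>M - B c\<^sub>0. 1 + (real (card (nbhd E u \<inter> M)) + 1) / s)"
    proof (rule sum_mono)
      fix u assume u: "u \<in> M - B c\<^sub>0"
      have s: "y u - 1 \<ge> s" "y u - 1 > 0" using y[OF u] \<open>s > 0\<close> by auto
      have "(\<Sum>x | x \<in> L v \<and> x \<in> A u. 1 / (y u - 1)) =
          card {x \<in> L v. x \<in> A u} / (y u - 1)" by simp
      also have "\<dots> \<le> card (A u) / (y u - 1)"
        using s finA u by (intro divide_right_mono of_nat_mono card_mono) auto
      \<comment> \<open>By definition of \<open>y\<close>, \<open>card (A u)\<close> is
        \<open>y u - 1\<close> plus the number of neighbours of \<open>u\<close> in \<open>M\<close>
        plus 1.\<close>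
      also have "\<dots> = 1 + (real (card (nbhd E u \<inter> M)) + 1) / (y u - 1)"
        using s by (simp add: field_simps y_def)
      also have "\<dots> \<le> 1 + (real (card (nbhd E u \<inter> M)) + 1) / s"
        using s \<open>s > 0\<close> by (intro add_left_mono divide_left_mono) auto
      finally show "(\<Sum>x | x \<in> L v \<and> x \<in> A u. 1 / (y u - 1))
        \<le> 1 + (real (card (nbhd E u \<inter> M)) + 1) / s" .
    qed
    also have "\<dots> \<le> (\<Sum>u\<in>M. 1 + (real (card (nbhd E u \<inter> M)) + 1) / s)"
      using finM \<open>s > 0\<close> by (intro sum_mono2) (auto intro!: add_nonneg_nonneg divide_nonneg_nonneg)
    finally show ?thesis using a by simp
  qed
  \<comment> \<open>Double counting of pairs of a colour and a colouring that avoids it on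
    \<open>S c\<close>; used with the bad set first and with all of \<open>M\<close> at the
    end.\<close>
  have count: "(\<Sum>x\<in>L v. card {c \<in> K. x \<notin> c ` S c}) = (\<Sum>c\<in>K. card (L v - c ` S c))" for S
    using finK fin by (intro sum_multicount_gen) (auto simp: set_diff_eq)
  have "(\<Sum>c\<in>K. exp (- \<theta>) * ((1 + \<theta>) * (real (card (L v)) - card (B c)) - a))
      \<le> exp (- \<theta>) * ((1 + \<theta>) * (\<Sum>c\<in>K. real (card (L v - c ` B c\<^sub>0))) - card K * (\<Sum>x\<in>L v. \<sigma> x))"
  proof -
    have "real (card (L v)) - card (B c) \<le> card (L v - c ` B c\<^sub>0)" if "c \<in> K" for c
    proof -
      have finB: "finite (B c\<^sub>0)" using finM by (simp add: B_def)
      have "card (L v) \<le> card (L v - c ` B c\<^sub>0) + card (c ` B c\<^sub>0)"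
        using diff_card_le_card_Diff[of "c ` B c\<^sub>0" "L v"] finB by simp
      also have "card (c ` B c\<^sub>0) \<le> card (B c)" using BK[OF that] finB by (simp add: card_image_le)
      finally show ?thesis by simp
    qed
    then have "(\<Sum>c\<in>K. (1 + \<theta>) * (real (card (L v)) - card (B c)) - a)
        \<le> (\<Sum>c\<in>K. (1 + \<theta>) * card (L v - c ` B c\<^sub>0) - (\<Sum>x\<in>L v. \<sigma> x))"
      using \<sigma> \<open>\<theta> \<ge> 0\<close> by (intro sum_mono diff_mono mult_left_mono) auto
    also have "\<dots> = (1 + \<theta>) * (\<Sum>c\<in>K. real (card (L v - c ` B c\<^sub>0))) - card K * (\<Sum>x\<in>L v. \<sigma> x)"
      by (simp add: sum_subtractf sum_distrib_left)
    finally show ?thesis by (simp flip: sum_distrib_left)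
  qed
  also have "\<dots> = (\<Sum>x\<in>L v. exp (- \<theta>) * ((1 + \<theta>) * card {c \<in> K. x \<notin> c ` B c\<^sub>0} - card K * \<sigma> x))"
    using count[of "\<lambda>_. B c\<^sub>0"]
    by (simp add: sum_subtractf flip: sum_distrib_left of_nat_sum)
  also have "\<dots> \<le> (\<Sum>x\<in>L v. real (card {c \<in> K. x \<notin> c ` M}))"
    by (intro sum_mono x)
  also have "\<dots> = (\<Sum>c\<in>K. real (card (available E L c T v)))"
    using count[of "\<lambda>_. M"] by (simp add: available_def M_def flip: of_nat_sum)
  finally show ?thesis by (simp add: K_def)
qed

text \<open>The bound for a single class is summed over all classes.\<close>

lemma sum_available_ge:
  fixes s a \<theta> :: real
  assumes fin: "finite T" "\<And>u. u \<in> insert v T \<Longrightarrow> finite (L u)"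
    and loopless: "\<And>u. u \<notin> nbhd E u" and "s > 0" "\<theta> \<ge> 0"
  defines "M \<equiv> nbhd E v \<inter> T"
  defines "B \<equiv> \<lambda>c. {u \<in> M. card (available E L c (T - M) u) < real (card (nbhd E u \<inter> M)) + 1 + s}"
  assumes a: "(\<Sum>u\<in>M. 1 + (real (card (nbhd E u \<inter> M)) + 1) / s) \<le> a"
  shows "(\<Sum>c\<in>proper_list_colourings T E L.
      exp (- \<theta>) * ((1 + \<theta>) * (real (card (L v)) - card (B c)) - a))
    \<le> (\<Sum>c\<in>proper_list_colourings T E L. real (card (available E L c T v)))"
proof -
  let ?P = "proper_list_colourings T E L"
  let ?r = "\<lambda>c. restrict c (T - M)"
  have "finite ?P" using fin by (intro finite_proper_list_colourings) auto
  then have group: "(\<Sum>c\<in>?P. h c) = (\<Sum>c\<^sub>0\<in>?r ` ?P. \<Sum>c\<in>colouring_class T E L M c\<^sub>0. h c)"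
    for h :: "_ \<Rightarrow> real"
    unfolding colouring_class_def by (rule sum.image_gen)
  show ?thesis
    unfolding group B_def M_def
    by (intro sum_mono sum_available_class_ge fin loopless \<open>s > 0\<close> \<open>\<theta> \<ge> 0\<close> a[unfolded M_def])
qed

text \<open>By linearity of expectation it suffices to treat one \<open>u\<close>. Having few
  colours relative to \<open>T - M\<close> implies having few relative to \<open>T - {u}\<close>,
  which has probability at most \<open>t u / l\<close> by the growth assumption
  \<open>step\<close>.\<close>

lemma sum_card_few_available_le:
  fixes t :: "'v \<Rightarrow> real" and l :: real
  assumes fin: "finite T" "\<And>u. u \<in> T \<Longrightarrow> finite (L u)" and loopless: "\<And>u. u \<notin> nbhd E u"
    and "l > 0" "M \<subseteq> T" "\<And>u. u \<in> M \<Longrightarrow> t u \<ge> 0"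
    and step: "\<And>u. u \<in> M \<Longrightarrow>
      l * card (proper_list_colourings (T - {u}) E L) \<le> card (proper_list_colourings T E L)"
  shows "(\<Sum>c\<in>proper_list_colourings T E L.
      real (card {u \<in> M. card (available E L c (T - M) u) < t u}))
    \<le> card (proper_list_colourings T E L) * ((\<Sum>u\<in>M. t u) / l)"
proof -
  let ?P = "\<lambda>T. proper_list_colourings T E L"
  have finP: "finite (?P T)" using fin by (rule finite_proper_list_colourings)
  have finM: "finite M" using assms finite_subset by blast
  have "(\<Sum>c\<in>?P T. card {u \<in> M. card (available E L c (T - M) u) < t u})
      = (\<Sum>u\<in>M. card {c \<in> ?P T. card (available E L c (T - M) u) < t u})"
    using finP finM by (intro sum_multicount_gen) auto
  then have "(\<Sum>c\<in>?P T. real (card {u \<in> M. card (available E L c (T - M) u) < t u}))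
      = (\<Sum>u\<in>M. real (card {c \<in> ?P T. card (available E L c (T - M) u) < t u}))"
    by (simp flip: of_nat_sum)
  also have "\<dots> \<le> (\<Sum>u\<in>M. t u * (card (?P T) / l))"
  proof (rule sum_mono)
    fix u assume u: "u \<in> M"
    have uT: "insert u (T - {u}) = T" using u \<open>M \<subseteq> T\<close> by auto
    have mono: "card (available E L c (T - {u}) u) \<le> card (available E L c (T - M) u)" for c
      using u \<open>M \<subseteq> T\<close> fin by (intro card_mono finite_available) (auto simp: available_def)
    have "real (card {c \<in> ?P T. card (available E L c (T - M) u) < t u})
        \<le> card {c \<in> ?P T. card (available E L c (T - {u}) u) < t u}"
      using finP mono by (intro of_nat_mono card_mono) (auto intro: le_less_trans[OF of_nat_mono])
    also have "\<dots> \<le> t u * card (?P (T - {u}))"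
      using card_few_available[of "T - {u}" u L E "t u"] uT u assms by auto
    also have "\<dots> \<le> t u * (card (?P T) / l)"
      using step[OF u] assms u by (intro mult_left_mono) (auto simp: field_simps)
    finally show "real (card {c \<in> ?P T. card (available E L c (T - M) u) < t u})
        \<le> t u * (card (?P T) / l)" .
  qed
  also have "\<dots> = card (?P T) * ((\<Sum>u\<in>M. t u) / l)"
    by (simp add: sum_distrib_left sum_divide_distrib mult.commute)
  finally show ?thesis .
qed

text \<open>The lower bound for the available colours decreases linearly in the number of bad
  vertices, so only its mean enters, and that is at most \<open>b\<close>. The tangent point
  \<open>\<theta>\<close> is still free.\<close>

lemma extension_ratio:
  fixes l s a b \<theta> :: real
  assumes fin: "finite T" "\<And>u. u \<in> insert v T \<Longrightarrow> finite (L u)"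
    and loopless: "\<And>u. u \<notin> nbhd E u" and "v \<notin> T" and "l > 0" "s > 0" "\<theta> \<ge> 0"
    and step: "\<And>u. u \<in> T \<Longrightarrow>
      l * card (proper_list_colourings (T - {u}) E L) \<le> card (proper_list_colourings T E L)"
  defines "M \<equiv> nbhd E v \<inter> T"
  assumes a: "(\<Sum>u\<in>M. 1 + (real (card (nbhd E u \<inter> M)) + 1) / s) \<le> a"
    and b: "(\<Sum>u\<in>M. real (card (nbhd E u \<inter> M)) + 1 + s) / l \<le> b"
    and l: "l \<le> exp (- \<theta>) * ((1 + \<theta>) * (card (L v) - b) - a)"
  shows "l * card (proper_list_colourings T E L) \<le> card (proper_list_colourings (insert v T) E L)"
proof -
  let ?P = "proper_list_colourings T E L"
  let ?b = "\<lambda>c. real (card {u \<in> M. card (available E L c (T - M) u) < real (card (nbhd E u \<inter> M)) + 1 + s})"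
  have "(\<Sum>c\<in>?P. ?b c) \<le> card ?P * ((\<Sum>u\<in>M. real (card (nbhd E u \<inter> M)) + 1 + s) / l)"
    using fin \<open>l > 0\<close> \<open>s > 0\<close>
    by (intro sum_card_few_available_le loopless step) (auto simp: M_def)
  also have "\<dots> \<le> card ?P * b" using b by (intro mult_left_mono) auto
  finally have bad: "(\<Sum>c\<in>?P. ?b c) \<le> card ?P * b" .
  have "l * card ?P \<le> exp (- \<theta>) * ((1 + \<theta>) * (card (L v) - b) - a) * card ?P"
    using l by (intro mult_right_mono) auto
  also have "\<dots> = exp (- \<theta>) * ((1 + \<theta>) * (card ?P * card (L v) - card ?P * b) - card ?P * a)"
    by (simp add: algebra_simps)
  also have "\<dots> \<le> exp (- \<theta>) *
      ((1 + \<theta>) * (card ?P * card (L v) - (\<Sum>c\<in>?P. ?b c)) - card ?P * a)"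
    using bad \<open>\<theta> \<ge> 0\<close> by (intro mult_left_mono diff_mono) auto
  also have "\<dots> = (\<Sum>c\<in>?P. exp (- \<theta>) * ((1 + \<theta>) * (real (card (L v)) - ?b c) - a))"
    by (simp add: sum_subtractf flip: sum_distrib_left)
  also have "\<dots> \<le> (\<Sum>c\<in>?P. real (card (available E L c T v)))"
    unfolding M_def
    by (intro sum_available_ge fin loopless \<open>s > 0\<close> \<open>\<theta> \<ge> 0\<close> a[unfolded M_def])
  also have "\<dots> = card (proper_list_colourings (insert v T) E L)"
    using fin \<open>v \<notin> T\<close> loopless by (subst card_extensions) auto
  finally show ?thesis .
qed

section \<open>The Lambert function and numerical estimates\<close>

text \<open>The intermediate value theorem on [0, y] gives surjectivity, because y exp y \<ge> y;
  hence \<open>inv_into\<close> is a right inverse.\<close>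

lemma lambert_W:
  assumes "y \<ge> 0"
  shows "lambert_W y \<ge> 0" "lambert_W y * exp (lambert_W y) = y"
proof -
  have "\<exists>z\<ge>0. z \<le> y \<and> z * exp z = y"
    using assms by (intro IVT2' IVT' continuous_intros) (auto simp: mult_le_cancel_left1)
  then have "y \<in> (\<lambda>z. z * exp z) ` {0..}" by auto
  then show "lambert_W y \<ge> 0" "lambert_W y * exp (lambert_W y) = y"
    unfolding lambert_W_def using inv_into_into[of y "\<lambda>z. z * exp z" "{0..}"]
      f_inv_into_f[of y "\<lambda>z. z * exp z" "{0..}"] by auto
qed

lemma div_lambert_W_eq:
  assumes "l > 0" "x \<ge> 0"
  shows "div_lambert_W l x = l * exp (lambert_W (x / l))"
proof -
  define w where "w = lambert_W (x / l)"
  have w: "w * exp w = x / l" using lambert_W[of "x / l"] assms by (simp add: w_def)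
  show ?thesis
  proof (cases "x = 0")
    case True
    then have "w = 0" using w by simp
    then show ?thesis using True by (simp add: div_lambert_W_def w_def)
  next
    case False
    then have "w \<noteq> 0" using w assms by auto
    have "x = l * w * exp w" using w assms by (simp add: field_simps)
    then have "x / w = l * exp w" using \<open>w \<noteq> 0\<close> by simp
    then show ?thesis using False by (simp add: div_lambert_W_def w_def)
  qed
qed

lemma ln_ge_17:
  assumes "\<rho> \<ge> (6 :: real)"
  shows "ln \<rho> \<ge> 17 / 10"
proof -
  \<comment> \<open>Splitting into 16 factors makes the quadratic bound on exp sharp enough to stay
    below 6.\<close>
  have "exp (17 / 10 :: real) = exp (17 / 160) ^ 16"
    by (simp flip: exp_of_nat_mult)
  also have "\<dots> \<le> (1 + 17 / 160 + (17 / 160)\<^sup>2) ^ 16"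
    by (intro power_mono exp_bound) auto
  also have "\<dots> \<le> 6" by (simp add: power_divide power2_eq_square)
  finally have "exp (17 / 10) \<le> \<rho>" using assms by simp
  then show ?thesis using assms ln_ge_iff[of \<rho> "17 / 10"] by simp
qed

text \<open>With m = ln \<rho>, a larger value would force y > (m - 1) \<rho> / e, which exceeds
  \<rho> / m^3 because (m - 1) m^3 > e.\<close>

lemma lambert_W_le_ln_minus_one:
  assumes "\<rho> \<ge> 6" "y \<ge> 0" "y \<le> \<rho> / ln \<rho> ^ 3"
  shows "lambert_W y \<le> ln \<rho> - 1"
proof (rule ccontr)
  let ?w = "lambert_W y" and ?m = "ln \<rho>"
  assume "\<not> ?w \<le> ?m - 1"
  have m: "?m \<ge> 17 / 10" using assms ln_ge_17 by simp
  \<comment> \<open>The left-hand side is about 3.44, and e \<le> 3.\<close>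
  have "(17 / 10 - 1) * (17 / 10) ^ 3 \<le> (?m - 1) * ?m ^ 3"
    using m by (intro mult_mono power_mono) auto
  then have "exp 1 < (?m - 1) * ?m ^ 3" using exp_le by (simp add: power_divide)
  then have "\<rho> * exp 1 < \<rho> * ((?m - 1) * ?m ^ 3)"
    using assms by (intro mult_strict_left_mono) auto
  then have "\<rho> / ?m ^ 3 < (?m - 1) * (\<rho> / exp 1)"
    using m by (simp add: field_simps)
  also have "\<rho> / exp 1 = exp (?m - 1)" using assms by (simp add: exp_diff)
  also have "(?m - 1) * exp (?m - 1) \<le> ?w * exp ?w"
    using m \<open>\<not> ?w \<le> ?m - 1\<close> by (intro mult_mono) auto
  also have "\<dots> = y" using assms lambert_W by simp
  finally show False using assms by simp
qed

text \<open>Here \<open>k\<close> is the list size, \<open>D\<close> the degree, \<open>m\<close> is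
  ln \<rho> and \<open>w\<close> is W(D / l). Of the surplus \<open>2 / m\<close>, one half pays for
  the bad vertices and the other matches the factor \<open>1 + 1 / m\<close> of
  \<open>D\<close>.\<close>

lemma ratio_estimate:
  fixes d l w k D m :: real
  assumes "l > 0" "l \<ge> (d + 1) * m ^ 3" "m > 0" "0 \<le> w" "w \<le> m - 1"
    and D: "D = l * (w * exp w)" and k: "k \<ge> (1 + 2 / m) * (l * exp w)"
  shows "l \<le> exp (- w) * ((1 + w) * (k - D * ((d + 1) * (1 + m)) / l) - D * (1 + 1 / m))"
proof -
  have "w * (1 + m) \<le> (m - 1) * (1 + m)" using assms by (intro mult_right_mono) auto
  also have "\<dots> \<le> m ^ 2" by (simp add: algebra_simps power2_eq_square)
  finally have w: "w * (1 + m) \<le> m ^ 2" .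
  \<comment> \<open>The bound on the expected number of bad vertices: \<open>w * (1 + m)\<close>
    costs \<open>m ^ 2\<close>, and the cube in the lower bound on \<open>l\<close> leaves a gain of
    \<open>1 / m\<close>.\<close>
  have "D * ((d + 1) * (1 + m)) / l = exp w * (w * (1 + m)) * (d + 1)"
    using assms by (simp add: D)
  also have "\<dots> \<le> exp w * (w * (1 + m)) * (l / m ^ 3)"
    using assms by (intro mult_left_mono) (auto simp: field_simps)
  also have "\<dots> \<le> exp w * m ^ 2 * (l / m ^ 3)"
    using assms w by (intro mult_right_mono mult_left_mono) auto
  also have "\<dots> = l * exp w / m" using assms by (simp add: field_simps power2_eq_square power3_eq_cube)
  finally have "D * ((d + 1) * (1 + m)) / l \<le> l * exp w / m" .
  moreover have "k \<ge> l * exp w + 2 * (l * exp w / m)"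
    using k by (simp add: distrib_right)
  moreover have "(1 + 1 / m) * (l * exp w) = l * exp w + l * exp w / m"
    by (simp add: distrib_right)
  ultimately have "k - D * ((d + 1) * (1 + m)) / l \<ge> (1 + 1 / m) * (l * exp w)"
    by linarith
  then have "(1 + w) * ((1 + 1 / m) * (l * exp w)) - D * (1 + 1 / m)
      \<le> (1 + w) * (k - D * ((d + 1) * (1 + m)) / l) - D * (1 + 1 / m)"
    using assms by (intro diff_right_mono mult_left_mono) auto
  \<comment> \<open>This is why the tangent point is \<open>w\<close>: since
    \<open>D = l * w * exp w\<close>, the difference \<open>(1 + w) * l * exp w - D\<close> is just
    \<open>l * exp w\<close>.\<close>
  also have "(1 + w) * ((1 + 1 / m) * (l * exp w)) - D * (1 + 1 / m) = exp w * (l * (1 + 1 / m))"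
    by (simp add: D algebra_simps add_divide_distrib)
  finally have "exp (- w) * (exp w * (l * (1 + 1 / m)))
      \<le> exp (- w) * ((1 + w) * (k - D * ((d + 1) * (1 + m)) / l) - D * (1 + 1 / m))"
    by (intro mult_left_mono) auto
  moreover have "exp (- w) * (exp w * (l * (1 + 1 / m))) = l * (1 + 1 / m)"
    by (simp add: exp_minus)
  moreover have "l \<le> l * (1 + 1 / m)" using assms by (simp add: algebra_simps)
  ultimately show ?thesis by linarith
qed

section \<open>Local sparsity and the induction over vertex sets\<close>

lemma simple_graph_nbhd:
  assumes "simple_graph V E"
  shows "u \<notin> nbhd E u" and "nbhd E u \<subseteq> V"
  using assms by (auto simp: simple_graph_def nbhd_def)

text \<open>The number of common neighbours of \<open>u\<close> and \<open>v\<close> is the degree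
  of \<open>u\<close> in the graph induced on \<open>nbhd E v\<close>, so the sum is average degree
  times number of vertices.\<close>

lemma sum_codegree_le:
  assumes "simple_graph V E" and "average_degree (nbhd E v) (induced_edges E (nbhd E v)) \<le> d"
  shows "(\<Sum>u\<in>nbhd E v. real (card (nbhd E u \<inter> nbhd E v))) \<le> d * vertex_degree E v"
proof (cases "nbhd E v = {}")
  case False
  have "finite (nbhd E v)"
    using simple_graph_nbhd(2)[OF assms(1)] assms(1) by (metis finite_subset simple_graph_def)
  then have "card (nbhd E v) > 0" using False by (simp add: card_gt_0_iff)
  moreover have "vertex_degree (induced_edges E (nbhd E v)) u = card (nbhd E u \<inter> nbhd E v)"
    if "u \<in> nbhd E v" for u
    using that unfolding vertex_degree_def
    by (intro arg_cong[where f = card]) (auto simp: nbhd_def induced_edges_def)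
  ultimately show ?thesis
    using assms(2) by (simp add: average_degree_def vertex_degree_def[of E v] field_simps)
qed (simp add: vertex_degree_def)

lemma power_le_card_colourings:
  fixes d \<rho> l :: real
  assumes graph: "simple_graph V E" and fin: "\<And>v. v \<in> V \<Longrightarrow> finite (L v)" and "T \<subseteq> V"
    and sparse: "\<And>u. u \<in> V \<Longrightarrow> average_degree (nbhd E u) (induced_edges E (nbhd E u)) \<le> d"
    and "d \<ge> 0" "\<rho> \<ge> 6"
    and deg: "\<And>v. v \<in> V \<Longrightarrow> vertex_degree E v \<le> \<rho> * (d + 1)"
    and l: "l \<ge> (d + 1) * ln \<rho> ^ 3"
    and L: "\<And>v. v \<in> V \<Longrightarrow>
      card (L v) \<ge> (1 + 2 / ln \<rho>) * div_lambert_W l (real (vertex_degree E v))"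
  shows "l ^ card T \<le> card (proper_list_colourings T E L)"
proof -
  let ?m = "ln \<rho>"
  let ?P = "\<lambda>T. proper_list_colourings T E L"
  \<comment> \<open>With this \<open>s\<close> the excess \<open>D * (d + 1) / s\<close> in the sum
    of the exponents is \<open>D / ln \<rho>\<close>, while the thresholds for being bad add up to
    at most \<open>D * (d + 1) * (1 + ln \<rho>)\<close>.\<close>
  define s where "s = (d + 1) * ?m"
  have m: "?m > 0" using ln_ge_17[OF \<open>\<rho> \<ge> 6\<close>] by linarith
  then have "s > 0" using \<open>d \<ge> 0\<close> by (simp add: s_def)
  have "(d + 1) * ?m ^ 3 > 0" using m \<open>d \<ge> 0\<close> by simp
  then have "l > 0" using l by linarith
  have "finite V" using graph by (simp add: simple_graph_def)
  note nbhd = simple_graph_nbhd[OF graph]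
  \<comment> \<open>The ratio is proved for every vertex of every subset, not along one fixed order:
    the bound on bad vertices needs it for deleting any \<open>u\<close> from
    \<open>T - {v}\<close>.\<close>
  have ratio: "l * card (?P (T - {v})) \<le> card (?P T)" if "T \<subseteq> V" "v \<in> T" for T v
  proof -
    have "finite T" using that \<open>finite V\<close> finite_subset by blast
    then show ?thesis using that
    proof (induction T arbitrary: v rule: finite_psubset_induct)
      case (psubset T)
      let ?T = "T - {v}" and ?N = "nbhd E v" and ?D = "real (vertex_degree E v)"
      let ?M = "?N \<inter> ?T"
      have vV: "v \<in> V" using psubset.prems by auto
      have finN: "finite ?N" using nbhd \<open>finite V\<close> finite_subset by blast
      define w where "w = lambert_W (?D / l)"
      have w: "w \<ge> 0" "w * exp w = ?D / l" using lambert_W[of "?D / l"] \<open>l > 0\<close> by (auto simp: w_def)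
      \<comment> \<open>The degree bound and the lower bound on \<open>l\<close> cancel the factor
        \<open>d + 1\<close>.\<close>
      have "?D / l \<le> \<rho> * (d + 1) / ((d + 1) * ?m ^ 3)"
        using deg[OF vV] l m \<open>d \<ge> 0\<close> \<open>\<rho> \<ge> 6\<close> by (intro frac_le) auto
      also have "\<dots> = \<rho> / ?m ^ 3" using \<open>d \<ge> 0\<close> by simp
      finally have w_le: "w \<le> ?m - 1"
        unfolding w_def using \<open>\<rho> \<ge> 6\<close> \<open>l > 0\<close> by (intro lambert_W_le_ln_minus_one) auto
      have cardM: "real (card ?M) \<le> ?D"
        unfolding vertex_degree_def using finN by (intro of_nat_mono card_mono) auto
      have "(\<Sum>u\<in>?M. real (card (nbhd E u \<inter> ?M))) \<le> (\<Sum>u\<in>?M. real (card (nbhd E u \<inter> ?N)))"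
        using finN by (intro sum_mono of_nat_mono card_mono) auto
      also have "\<dots> \<le> (\<Sum>u\<in>?N. real (card (nbhd E u \<inter> ?N)))"
        using finN by (intro sum_mono2) auto
      also have "\<dots> \<le> d * ?D" using graph sparse[OF vV] by (rule sum_codegree_le)
      finally have codeg: "(\<Sum>u\<in>?M. real (card (nbhd E u \<inter> ?M))) \<le> d * ?D" .
      then have codeg1: "(\<Sum>u\<in>?M. real (card (nbhd E u \<inter> ?M)) + 1) \<le> ?D * (d + 1)"
        using cardM by (simp add: sum.distrib algebra_simps)
      have "l * card (?P ?T) \<le> card (?P (insert v ?T))"
      proof (rule extension_ratio[where s = s and \<theta> = w])
        show "l * card (?P (?T - {u})) \<le> card (?P ?T)" if "u \<in> ?T" for u
          using that psubset.prems by (intro psubset.IH) auto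
        have "(\<Sum>u\<in>?M. 1 + (real (card (nbhd E u \<inter> ?M)) + 1) / s)
            = card ?M + (\<Sum>u\<in>?M. real (card (nbhd E u \<inter> ?M)) + 1) / s"
          by (subst sum.distrib) (simp add: sum_divide_distrib)
        also have "\<dots> \<le> ?D + ?D * (d + 1) / s"
          using cardM codeg1 \<open>s > 0\<close> by (intro add_mono divide_right_mono) auto
        also have "\<dots> = ?D * (1 + 1 / ?m)"
        proof -
          have "(d + 1) / s = 1 / ?m" using \<open>d \<ge> 0\<close> by (simp add: s_def)
          then have "?D * (d + 1) / s = ?D * (1 / ?m)" by (metis times_divide_eq_right)
          then show ?thesis by (simp add: distrib_left)
        qed
        finally show "(\<Sum>u\<in>?M. 1 + (real (card (nbhd E u \<inter> ?M)) + 1) / s) \<le> ?D * (1 + 1 / ?m)" .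
        have "(\<Sum>u\<in>?M. real (card (nbhd E u \<inter> ?M)) + 1 + s)
            = (\<Sum>u\<in>?M. real (card (nbhd E u \<inter> ?M)) + 1) + card ?M * s"
          by (simp add: sum.distrib)
        also have "\<dots> \<le> ?D * (d + 1) + ?D * s"
          using codeg1 cardM \<open>s > 0\<close> by (intro add_mono mult_right_mono) auto
        also have "\<dots> = ?D * ((d + 1) * (1 + ?m))" by (simp add: s_def algebra_simps)
        finally show "(\<Sum>u\<in>?M. real (card (nbhd E u \<inter> ?M)) + 1 + s) / l
            \<le> ?D * ((d + 1) * (1 + ?m)) / l"
          using \<open>l > 0\<close> by (intro divide_right_mono) auto
        show "l \<le> exp (- w) * ((1 + w) * (card (L v) - ?D * ((d + 1) * (1 + ?m)) / l)
            - ?D * (1 + 1 / ?m))"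
        proof (rule ratio_estimate)
          show "?D = l * (w * exp w)" using w \<open>l > 0\<close> by simp
          show "(1 + 2 / ?m) * (l * exp w) \<le> card (L v)"
            using L[OF vV] \<open>l > 0\<close> by (simp add: div_lambert_W_eq w_def)
        qed (use \<open>l > 0\<close> l m w w_le in auto)
      qed (use psubset fin nbhd \<open>l > 0\<close> \<open>s > 0\<close> w in auto)
      then show ?case using psubset.prems by (simp add: insert_absorb)
    qed
  qed
  have "finite T" using \<open>T \<subseteq> V\<close> \<open>finite V\<close> finite_subset by blast
  then show ?thesis using \<open>T \<subseteq> V\<close>
  proof (induction T)
    case empty
    then show ?case by (simp add: proper_list_colourings_def)
  next
    case (insert v T)
    have "l * l ^ card T \<le> l * card (?P T)"
      using insert \<open>l > 0\<close> by (intro mult_left_mono) auto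
    also have "\<dots> \<le> card (?P (insert v T))" using ratio[of "insert v T" v] insert by simp
    finally show ?case using insert.hyps by simp
  qed
qed

section \<open>Reduction to finite lists and conclusion\<close>

lemma card_at_least_obtains_finite:
  assumes "card_at_least A r"
  obtains B where "B \<subseteq> A" "finite B" "real (card B) \<ge> r"
proof (cases "finite A")
  case True
  then show ?thesis using assms that[of A] by (auto simp: card_at_least_def)
next
  case False
  then obtain B where "B \<subseteq> A" "finite B" "card B = nat \<lceil>r\<rceil>"
    by (meson infinite_arbitrarily_large)
  then show ?thesis using that[of B] by (simp add: real_nat_ceiling_ge)
qed

lemma card_at_least_superset:
  assumes "finite B" "B \<subseteq> A" "r \<le> real (card B)"
  shows "card_at_least A r"
proof (cases "finite A")
  case True
  then have "card B \<le> card A" using assms(2) by (intro card_mono)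
  then show ?thesis using assms(3) by (simp add: card_at_least_def)
qed (simp add: card_at_least_def)

theorem theorem1:
  fixes V :: "'v set" and E :: "'v set set" and n \<Delta> :: nat and d \<rho> l :: real
    and L :: "'v \<Rightarrow> nat set"
  assumes "simple_graph V E"
    and "card V = n"
    and "max_degree V E = \<Delta>"
    and "\<And>u. u \<in> V \<Longrightarrow> average_degree (nbhd E u) (induced_edges E (nbhd E u)) \<le> d"
    and "d \<le> real \<Delta> / 6 - 1"
    and "\<rho> = real \<Delta> / (d + 1)"
    and "l \<ge> (d + 1) * (ln \<rho>) ^ 3"
    and "\<And>v. v \<in> V \<Longrightarrow>
           card_at_least (L v) ((1 + 2 / ln \<rho>) * div_lambert_W l (real (vertex_degree E v)))"
  shows "card_at_least (proper_list_colourings V E L) (l ^ n)"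
\<comment> \<open>Without vertices there is one colouring and \<open>l ^ 0 = 1\<close>. Otherwise
  some vertex exists, and its average degree being nonnegative forces
  \<open>d \<ge> 0\<close>.\<close>
proof (cases "V = {}")
  case True
  then show ?thesis using assms(2) by (simp add: proper_list_colourings_def card_at_least_def)
next
  case False
  have "finite V" using assms(1) by (simp add: simple_graph_def)
  obtain u where "u \<in> V" using False by auto
  have "0 \<le> average_degree (nbhd E u) (induced_edges E (nbhd E u))"
    by (simp add: average_degree_def sum_nonneg)
  also have "\<dots> \<le> d" using assms(4)[OF \<open>u \<in> V\<close>] .
  finally have "d \<ge> 0" .
  then have "\<rho> \<ge> 6" using assms(5,6) by (simp add: pos_le_divide_eq)
  have "vertex_degree E v \<le> \<Delta>" if "v \<in> V" for v
    using that \<open>finite V\<close> assms(3) by (auto simp: max_degree_def)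
  then have deg: "real (vertex_degree E v) \<le> \<rho> * (d + 1)" if "v \<in> V" for v
    using that \<open>d \<ge> 0\<close> assms(6) by simp
  \<comment> \<open>Infinite lists are cut down to finite ones of sufficient size; this can only
    remove colourings, and the counting argument needs finite sums.\<close>
  have "\<forall>v\<in>V. \<exists>B. B \<subseteq> L v \<and> finite B \<and>
      real (card B) \<ge> (1 + 2 / ln \<rho>) * div_lambert_W l (real (vertex_degree E v))"
    by (meson assms(8) card_at_least_obtains_finite)
  from bchoice[OF this] obtain L' where L': "\<And>v. v \<in> V \<Longrightarrow> L' v \<subseteq> L v"
      "\<And>v. v \<in> V \<Longrightarrow> finite (L' v)"
      "\<And>v. v \<in> V \<Longrightarrow>
        real (card (L' v)) \<ge> (1 + 2 / ln \<rho>) * div_lambert_W l (real (vertex_degree E v))"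
    by blast
  show ?thesis
  proof (rule card_at_least_superset)
    show "finite (proper_list_colourings V E L')"
      using \<open>finite V\<close> L'(2) by (rule finite_proper_list_colourings)
    show "proper_list_colourings V E L' \<subseteq> proper_list_colourings V E L"
      using PiE_mono[of V L' L] L'(1) by (auto simp: proper_list_colourings_def)
    show "l ^ n \<le> card (proper_list_colourings V E L')"
      unfolding assms(2)[symmetric]
      by (rule power_le_card_colourings[OF assms(1) L'(2) subset_refl assms(4)
            \<open>d \<ge> 0\<close> \<open>\<rho> \<ge> 6\<close> deg assms(7) L'(3)])
  qed
qed

end
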